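(* Let $\mathcal U\subset\mathbb R^m$ be nonempty, closed, and convex. Suppose that for almost every $t\in[0,T]$ and for all relevant tuples $(\hat x,\hat\lambda)\in\hat{\mathcal D}_t$ and $(x,\hat x,\lambda)\in\mathcal D_t$, the maps $u\mapsto\hat H(t,\hat x,u,\hat\lambda)$ and $u\mapsto H(t,x,\hat x,u,\lambda)$ are proper, lower semicontinuous, and convex on $\mathcal U$, and coercive on $\mathcal U$ (that is, $\|u\|\to\infty$ with $u\in\mathcal U$ implies $\hat H(t,\hat x,u,\hat\lambda)\to+\infty$ and $H(t,x,\hat x,u,\lambda)\to+\infty$). Fix any time $t\in[0,T]$ (and relevant $(\hat x,\hat\lambda)\in\hat{\mathcal D}_t$, $(x,\hat x,\lambda)\in\mathcal D_t$) for which the pointwise Hamiltonian minimizers over $\mathcal U$ exist. Suppose there exists $\bar u\in\mathcal U$ such that $$\partial_u \hat H(t,\hat x,\bar u,\hat\lambda)=\partial_u H(t,x,\hat x,\bar u,\lambda)$$ and, in addition, $$0\in \partial_u \hat H(t,\hat x,\bar u,\hat\lambda)+N_{\mathcal U}(\bar u).$$ Then $\bar u$ is a minimizer for both pointwise Hamiltonian problems, i.e., $$\bar u\in\arg\min_{v\in\mathcal U}\hat H(t,\hat x,v,\hat\lambda)\quad\text{and}\quad \bar u\in\arg\min_{v\in\mathcal U}H(t,x,\hat x,v,\lambda).$$ If, moreover, each of the two Hamiltonians is strictly convex in $u$ on $\mathcal U$ at the time $t$ under consideration, then the two minimizers are unique and must coincide.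
   Context: Let $n,m\in\mathbb N$, $T>0$. Let $f,\hat f:[0,T]\times\mathbb R^n\times\mathbb R^m\to\mathbb R^n$ be the model and plant dynamics, $\ell:[0,T]\times\mathbb R^n\times\mathbb R^m\to\mathbb R$ a running cost, and $\beta:[0,T]\to[0,\infty)$ a weighting function. The plant Hamiltonian and the model-based penalized Hamiltonian are, for $x,\hat x,\lambda,\hat\lambda\in\mathbb R^n$ and $u\in\mathbb R^m$, $$\hat H(t,\hat x,u,\hat\lambda)=\ell(t,\hat x,u)+\hat\lambda^\top\hat f(t,\hat x,u),$$ $$H(t,x,\hat x,u,\lambda)=\ell(t,x,u)+\beta(t)\|x-\hat x\|^2+\lambda^\top f(t,x,u).$$ For each $t$, $\hat{\mathcal D}_t\subset\mathbb R^n\times\mathbb R^n$ and $\mathcal D_t\subset\mathbb R^n\times\mathbb R^n\times\mathbb R^n$ denote the given sets of "relevant" state/costate tuples $(\hat x,\hat\lambda)$ and $(x,\hat x,\lambda)$ for which the hypotheses are imposed. The normal cone to $\mathcal U$ at $u\in\mathcal U$ is $N_{\mathcal U}(u)=\{\eta\in\mathbb R^m:\langle\eta,v-u\rangle\le 0\ \forall v\in\mathcal U\}$. $\partial_u$ denotes the convex subdifferential with respect to $u$: for $\psi:\mathbb R^m\to\mathbb R\cup\{+\infty\}$ and $u$ with $\psi(u)<\infty$, $\partial\psi(u)=\{s\in\mathbb R^m:\psi(v)\ge\psi(u)+\langle s,v-u\rangle\ \forall v\in\mathbb R^m\}$. The sum of two sets is the Minkowski sum. *)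

theory Defs
  imports "HOL-Analysis.Analysis"
begin

definition plant_hamiltonian ::
  "(real \<Rightarrow> real^'n \<Rightarrow> real^'m \<Rightarrow> real) \<Rightarrow> (real \<Rightarrow> real^'n \<Rightarrow> real^'m \<Rightarrow> real^'n) \<Rightarrow>
   real \<Rightarrow> real^'n \<Rightarrow> real^'m \<Rightarrow> real^'n \<Rightarrow> real"
  where "plant_hamiltonian l fh t xh u lamh = l t xh u + lamh \<bullet> fh t xh u"

definition model_hamiltonian ::
  "(real \<Rightarrow> real^'n \<Rightarrow> real^'m \<Rightarrow> real) \<Rightarrow> (real \<Rightarrow> real) \<Rightarrow>
   (real \<Rightarrow> real^'n \<Rightarrow> real^'m \<Rightarrow> real^'n) \<Rightarrow>
   real \<Rightarrow> real^'n \<Rightarrow> real^'n \<Rightarrow> real^'m \<Rightarrow> real^'n \<Rightarrow> real"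
  where "model_hamiltonian l \<beta> f t x xh u lam =
    l t x u + \<beta> t * (norm (x - xh))\<^sup>2 + lam \<bullet> f t x u"

definition normal_cone :: "'a::real_inner set \<Rightarrow> 'a \<Rightarrow> 'a set"
  where "normal_cone U u = {\<eta>. \<forall>v\<in>U. \<eta> \<bullet> (v - u) \<le> 0}"

(* The affine minorant is required on the whole space, not only on a constraint set.
   The set is empty where \<psi> = \<infinity>. *)
definition subdifferential :: "('a::real_inner \<Rightarrow> ereal) \<Rightarrow> 'a \<Rightarrow> 'a set"
  where "subdifferential \<psi> u =
    {s. \<psi> u < \<infinity> \<and> (\<forall>v. \<psi> u + ereal (s \<bullet> (v - u)) \<le> \<psi> v)}"

definition proper_on :: "'a set \<Rightarrow> ('a \<Rightarrow> ereal) \<Rightarrow> bool"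
  where "proper_on U \<psi> \<longleftrightarrow> (\<forall>u\<in>U. \<psi> u \<noteq> -\<infinity>) \<and> (\<exists>u\<in>U. \<psi> u < \<infinity>)"

definition lsc_on :: "'a::topological_space set \<Rightarrow> ('a \<Rightarrow> ereal) \<Rightarrow> bool"
  where "lsc_on U \<psi> \<longleftrightarrow> (\<forall>u\<in>U. \<psi> u \<le> Liminf (at u within U) \<psi>)"

(* For bounded U the filter is trivial, so the condition holds vacuously. *)
definition coercive_on :: "'a::real_normed_vector set \<Rightarrow> ('a \<Rightarrow> real) \<Rightarrow> bool"
  where "coercive_on U h \<longleftrightarrow> filterlim h at_top (inf at_infinity (principal U))"

definition strictly_convex_on :: "'a::real_vector set \<Rightarrow> ('a \<Rightarrow> real) \<Rightarrow> bool"
  where "strictly_convex_on U h \<longleftrightarrow> convex U \<and>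
    (\<forall>u\<in>U. \<forall>v\<in>U. \<forall>a. u \<noteq> v \<and> 0 < a \<and> a < 1 \<longrightarrow>
      h ((1 - a) *\<^sub>R u + a *\<^sub>R v) < (1 - a) * h u + a * h v)"

definition regular_on :: "'a::real_normed_vector set \<Rightarrow> ('a \<Rightarrow> real) \<Rightarrow> bool"
  where "regular_on U h \<longleftrightarrow>
    proper_on U (\<lambda>u. ereal (h u)) \<and> lsc_on U (\<lambda>u. ereal (h u)) \<and>
    convex_on U h \<and> coercive_on U h"

definition argmin_on :: "'a set \<Rightarrow> ('a \<Rightarrow> real) \<Rightarrow> 'a set"
  where "argmin_on U h = {u. is_arg_min h (\<lambda>v. v \<in> U) u}"

end

theory Submission
  imports Defs
begin

text \<open>If \<open>0 = s + \<eta>\<close> with \<open>s\<close> a subgradient and \<open>\<eta>\<close> a normal vector at \<open>u\<close>, then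
  \<open>h v - h u \<ge> s \<bullet> (v - u) = - \<eta> \<bullet> (v - u) \<ge> 0\<close> for all \<open>v \<in> U\<close>, so \<open>u\<close> minimizes \<open>h\<close>
  over \<open>U\<close>. Equality of the subdifferentials transfers the inclusion from the plant
  to the model.\<close>

lemma argmin_on_iff: "u \<in> argmin_on U h \<longleftrightarrow> u \<in> U \<and> (\<forall>v\<in>U. h u \<le> h v)"
  by (auto simp: argmin_on_def is_arg_min_linorder)

lemma argmin_onI_stationary:
  assumes "u \<in> U" and "0 \<in> subdifferential (\<lambda>v. ereal (h v)) u + normal_cone U u"
  shows "u \<in> argmin_on U h"
proof -
  from assms(2) obtain s \<eta> where s: "s \<in> subdifferential (\<lambda>v. ereal (h v)) u"
    and \<eta>: "\<eta> \<in> normal_cone U u" and sum: "0 = s + \<eta>"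
    by (rule set_plus_elim)
  have "h u \<le> h v" if "v \<in> U" for v
  proof -
    \<comment> \<open>The affine minorant in \<open>subdifferential\<close> holds on the whole
      space, so in particular at the points of \<open>U\<close>; all values are finite, so the
      \<open>ereal\<close> inequality is a real one.\<close>
    have "h u + s \<bullet> (v - u) \<le> h v"
      using s by (simp add: subdifferential_def)
    moreover have "\<eta> \<bullet> (v - u) \<le> 0"
      using \<eta> that by (simp add: normal_cone_def)
    moreover have "s \<bullet> (v - u) + \<eta> \<bullet> (v - u) = 0"
      using sum by (metis inner_add_left inner_zero_left)
    ultimately show ?thesis by linarith
  qed
  with \<open>u \<in> U\<close> show ?thesis by (simp add: argmin_on_iff)
qed

text \<open>Two distinct minimizers would have a midpoint in \<open>U\<close> whose value lies
  strictly below the common minimum.\<close>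

lemma strictly_convex_on_argmin_unique:
  assumes h: "strictly_convex_on U h" and u: "u \<in> argmin_on U h" and v: "v \<in> argmin_on U h"
  shows "u = v"
proof (rule ccontr)
  assume "u \<noteq> v"
  \<comment> \<open>The weight is left as \<open>1 - 1/2\<close> to match the convex combination in
    \<open>strictly_convex_on\<close> at \<open>a = 1/2\<close>.\<close>
  define w where "w = (1 - 1/2) *\<^sub>R u + (1/2 :: real) *\<^sub>R v"
  have U: "u \<in> U" "v \<in> U" and "h u = h v"
    using u v by (auto simp: argmin_on_iff intro: antisym)
  \<comment> \<open>Convexity of \<open>U\<close> is part of \<open>strictly_convex_on\<close>, so
    the midpoint is admissible.\<close>
  have "w \<in> U"
    using h U unfolding strictly_convex_on_def w_def by (intro convexD) auto
  then have "h u \<le> h w"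
    using u by (simp add: argmin_on_iff)
  moreover have "h w < (1 - 1/2) * h u + (1/2) * h v"
  proof -
    have "\<forall>a. 0 < a \<and> a < 1 \<longrightarrow> h ((1 - a) *\<^sub>R u + a *\<^sub>R v) < (1 - a) * h u + a * h v"
      using h U \<open>u \<noteq> v\<close> unfolding strictly_convex_on_def by blast
    from spec[OF this, of "1/2"] show ?thesis
      unfolding w_def by simp
  qed
  ultimately show False
    using \<open>h u = h v\<close> by simp
qed

theorem theorem2:
  fixes T :: real
    and f fh :: "real \<Rightarrow> real^'n \<Rightarrow> real^'m \<Rightarrow> real^'n"
    and l :: "real \<Rightarrow> real^'n \<Rightarrow> real^'m \<Rightarrow> real"
    and \<beta> :: "real \<Rightarrow> real"
    and Dh :: "real \<Rightarrow> ((real^'n) \<times> (real^'n)) set"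
    and D :: "real \<Rightarrow> ((real^'n) \<times> (real^'n) \<times> (real^'n)) set"
    and U :: "(real^'m) set"
    and t :: real and x xh lam lamh :: "real^'n" and ubar :: "real^'m"
  assumes "T > 0"
    and "\<forall>s\<in>{0..T}. \<beta> s \<ge> 0"
    and "U \<noteq> {}" "closed U" "convex U"
    and "AE s in lebesgue_on {0..T}. \<forall>y yh p ph. (yh, ph) \<in> Dh s \<and> (y, yh, p) \<in> D s \<longrightarrow>
           regular_on U (\<lambda>u. plant_hamiltonian l fh s yh u ph) \<and>
           regular_on U (\<lambda>u. model_hamiltonian l \<beta> f s y yh u p)"
    and "t \<in> {0..T}"
    and "(xh, lamh) \<in> Dh t" "(x, xh, lam) \<in> D t"
    and "argmin_on U (\<lambda>u. plant_hamiltonian l fh t xh u lamh) \<noteq> {}"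
    and "argmin_on U (\<lambda>u. model_hamiltonian l \<beta> f t x xh u lam) \<noteq> {}"
    and "ubar \<in> U"
    and "subdifferential (\<lambda>u. ereal (plant_hamiltonian l fh t xh u lamh)) ubar =
         subdifferential (\<lambda>u. ereal (model_hamiltonian l \<beta> f t x xh u lam)) ubar"
    and "0 \<in> subdifferential (\<lambda>u. ereal (plant_hamiltonian l fh t xh u lamh)) ubar
             + normal_cone U ubar"
  shows "ubar \<in> argmin_on U (\<lambda>v. plant_hamiltonian l fh t xh v lamh) \<and>
         ubar \<in> argmin_on U (\<lambda>v. model_hamiltonian l \<beta> f t x xh v lam) \<and>
         (strictly_convex_on U (\<lambda>u. plant_hamiltonian l fh t xh u lamh) \<and>
          strictly_convex_on U (\<lambda>u. model_hamiltonian l \<beta> f t x xh u lam) \<longrightarrow>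
            (\<exists>!u. u \<in> argmin_on U (\<lambda>v. plant_hamiltonian l fh t xh v lamh)) \<and>
            (\<exists>!u. u \<in> argmin_on U (\<lambda>v. model_hamiltonian l \<beta> f t x xh v lam)) \<and>
            argmin_on U (\<lambda>v. plant_hamiltonian l fh t xh v lamh) =
            argmin_on U (\<lambda>v. model_hamiltonian l \<beta> f t x xh v lam))"
proof -
  let ?P = "\<lambda>v. plant_hamiltonian l fh t xh v lamh"
  let ?M = "\<lambda>v. model_hamiltonian l \<beta> f t x xh v lam"
  have P: "ubar \<in> argmin_on U ?P"
    using assms(12,14) by (rule argmin_onI_stationary)
  have M: "ubar \<in> argmin_on U ?M"
    \<comment> \<open>Rewriting with the equality of the subdifferentials turns stationarity for the
      plant into stationarity for the model.\<close>
    using assms(12) assms(14)[unfolded assms(13)] by (rule argmin_onI_stationary)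
  \<comment> \<open>Applied to both Hamiltonians, this gives existence, uniqueness and coincidence
    at once: each set of minimizers is the same singleton.\<close>
  have eq: "argmin_on U h = {ubar}" if "strictly_convex_on U h" "ubar \<in> argmin_on U h" for h
    using that by (auto dest: strictly_convex_on_argmin_unique)
  from P M show ?thesis
    by (auto simp: eq)
qed

end
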